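(* The positive elements of Thompson's group $F$ have colorings, and the prime positive elements of $F$ have unique colorings (uniqueness being modulo permutations of the three nonzero colors).
   Context: **Trees.** Finite binary trees are rooted, planar; every vertex has $0$ or two (ordered: left, right) children except the root $*$, which has degree $1$ and a single child $\emptyset$ (vertices other than the root are addressed by words over $\{0,1\}$, the children of $u$ being $u0$ and $u1$). Leaves are numbered left to right. The trivial tree has one leaf. All pairs $(D,R)$ of trees are assumed to have the same number of leaves. For a tree $A$ with at least $i$ leaves, $A^{(i)}$ denotes the tree obtained by attaching two children to the $i$-th leaf of $A$. **The group $F$.** Elements of $F$ are equivalence classes of pairs of finite binary trees with the same number of leaves, under the equivalence relation generated by $(A,B)\rightarrow(A^{(i)},B^{(i)})$. Multiplication satisfies $(A,B)(B,C)=(A,C)$. **Positive elements.** A right vine is a tree all of whose internal vertices are of the form $1^k$, $k\ge0$. A positive element of $F$ is one represented by a pair $(D,V)$ with $V$ a right vine. **Prime.** A tree with $n\ge 2$ leaves is dual to a triangulation (with no extra vertices) of an $(n+1)$-gon whose sides correspond in cyclic order to root and leaves; a pair is prime if the graph obtained by gluing the two dual triangulated polygons along their boundary has no parallel edges (no common diagonal). The prime positive elements are those represented by a prime pair $(D,V)$ with $V$ a right vine; these are the pairs $(D,V)$ with $V$ a right vine and the right subtree of $D$ trivial (the vertex $1$ of $D$ is a leaf). **Colorings.** Colors are elements of $\mathbb Z_2\times\mathbb Z_2$, coded $0=(0,0)$, $1=(0,1)$, $2=(1,0)$, $3=(1,1)$. A color vector $\mathbf c=(c_1,\dots,c_n)$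 for a tree with $n$ leaves determines the unique edge coloring in which the edge at the $i$-th leaf has color $c_i$ and the three edges at each internal vertex sum to $0$. It is valid for the tree if this is a proper edge coloring using only colors $1,2,3$. A coloring of a pair $(D,R)$ is a color vector valid for both $D$ and $R$. An element of $F$ has a coloring if a pair representing it has a coloring (this does not depend on the representative). Colorings are counted modulo the action of $S_3$ on $\{1,2,3\}$; that a prime positive element has a unique coloring means that the prime pair $(D,V)$ above has exactly one coloring modulo this action. *)

theory Defs
  imports
    "HOL-Algebra.Group"
    "HOL-Library.Z2"
    "HOL-Library.Product_Plus"
    "HOL-Combinatorics.Permutations"
begin

section \<open>Finite binary trees\<close>

text \<open>The degree-one root \<open>*\<close> above \<open>\<emptyset>\<close> is left implicit. The other
  vertices are words over \<open>{0,1}\<close>, written as lists with \<open>False\<close> for \<open>0\<close> and \<open>True\<close> for \<open>1\<close>;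
  the empty word is the child \<open>\<emptyset>\<close> of the root.\<close>

datatype tree = Leaf | Node tree tree

fun internal :: "tree \<Rightarrow> bool list set" where
  "internal Leaf = {}"
| "internal (Node l r) = {[]} \<union> (#) False ` internal l \<union> (#) True ` internal r"

fun leaf_list :: "tree \<Rightarrow> bool list list" where
  "leaf_list Leaf = [[]]"
| "leaf_list (Node l r) = map ((#) False) (leaf_list l) @ map ((#) True) (leaf_list r)"

abbreviation leaves :: "tree \<Rightarrow> nat" where
  "leaves t \<equiv> length (leaf_list t)"

definition vertices :: "tree \<Rightarrow> bool list set" where
  "vertices t = internal t \<union> set (leaf_list t)"

text \<open>\<open>add_caret i t\<close> attaches two children to a leaf of \<open>t\<close>. Here and below leaves are counted
  from \<open>0\<close>, so this is $t^{(i+1)}$; it is only used for \<open>i < leaves t\<close>.\<close>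

fun add_caret :: "nat \<Rightarrow> tree \<Rightarrow> tree" where
  "add_caret i Leaf = Node Leaf Leaf"
| "add_caret i (Node l r) =
    (if i < leaves l then Node (add_caret i l) r else Node l (add_caret (i - leaves l) r))"

definition right_vine :: "tree \<Rightarrow> bool" where
  "right_vine t \<longleftrightarrow> (\<forall>u \<in> internal t. \<exists>k. u = replicate k True)"


section \<open>Thompson's group\<close>

definition tree_pairs :: "(tree \<times> tree) set" where
  "tree_pairs = {(A, B). leaves A = leaves B}"

definition caret_step :: "((tree \<times> tree) \<times> (tree \<times> tree)) set" where
  "caret_step = {((A, B), (add_caret i A, add_caret i B)) |A B i. (A, B) \<in> tree_pairs \<and> i < leaves A}"

definition F_rel :: "((tree \<times> tree) \<times> (tree \<times> tree)) set" where
  "F_rel = Restr ((caret_step \<union> caret_step\<inverse>)\<^sup>*) tree_pairs"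

definition thompson_F :: "(tree \<times> tree) set monoid" where
  "thompson_F =
    \<lparr> carrier = tree_pairs // F_rel,
      monoid.mult = (\<lambda>X Y. F_rel `` {(A, C) |A B C. (A, B) \<in> X \<and> (B, C) \<in> Y}),
      monoid.one = F_rel `` {(Leaf, Leaf)} \<rparr>"

definition positive_elements :: "(tree \<times> tree) set set" where
  "positive_elements = {x \<in> carrier thompson_F. \<exists>D V. (D, V) \<in> x \<and> right_vine V}"


section \<open>Prime pairs\<close>

text \<open>The triangulation of the \<open>(n+1)\<close>-gon dual to a tree with \<open>n\<close> leaves: the polygon has corners
  \<open>0, \<dots>, n\<close>, the side dual to the edge at leaf number \<open>i\<close> (from \<open>0\<close>) is \<open>{i, i+1}\<close>, and the side
  dual to the edge at the root is \<open>{0, n}\<close>. The edge above a vertex whose descendant leaves are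
  exactly \<open>a, \<dots>, b-1\<close> is dual to the segment \<open>{a, b}\<close>. \<open>segments_from a t\<close> lists the dual segments
  of the edges of \<open>t\<close> when the leaves of \<open>t\<close> are numbered starting with \<open>a\<close>.\<close>

fun segments_from :: "nat \<Rightarrow> tree \<Rightarrow> nat set set" where
  "segments_from a Leaf = {{a, a + 1}}"
| "segments_from a (Node l r) =
    insert {a, a + leaves (Node l r)} (segments_from a l \<union> segments_from (a + leaves l) r)"

definition polygon_sides :: "nat \<Rightarrow> nat set set" where
  "polygon_sides n = insert {0, n} {{i, i + 1} |i. i < n}"

definition diagonals :: "tree \<Rightarrow> nat set set" where
  "diagonals t = segments_from 0 t - polygon_sides (leaves t)"

text \<open>The glued graph is a multigraph: the two polygons share their sides, but each keeps its own
  diagonals.\<close>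

datatype glued_edge =
    Boundary (ends: "nat set")
  | Fst_diagonal (ends: "nat set")
  | Snd_diagonal (ends: "nat set")

definition glued_edges :: "tree \<Rightarrow> tree \<Rightarrow> glued_edge set" where
  "glued_edges D R =
    Boundary ` polygon_sides (leaves D) \<union> Fst_diagonal ` diagonals D \<union> Snd_diagonal ` diagonals R"

definition prime_pair :: "tree \<Rightarrow> tree \<Rightarrow> bool" where
  "prime_pair D R \<longleftrightarrow> leaves D = leaves R \<and> leaves D \<ge> 2 \<and>
    (\<forall>e \<in> glued_edges D R. \<forall>e' \<in> glued_edges D R. e \<noteq> e' \<longrightarrow> ends e \<noteq> ends e')"

definition prime_positive_elements :: "(tree \<times> tree) set set" where
  "prime_positive_elements =
    {x \<in> carrier thompson_F. \<exists>D V. (D, V) \<in> x \<and> right_vine V \<and> prime_pair D V}"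


section \<open>Colorings\<close>

type_synonym color = "bit \<times> bit"

definition nonzero_colors :: "color set" where
  "nonzero_colors = {(0, 1), (1, 0), (1, 1)}"

text \<open>The edges of a tree are named by their lower endpoints, so that the edges at an internal
  vertex \<open>u\<close> are \<open>u\<close>, \<open>u0\<close>, \<open>u1\<close>. Values outside \<open>vertices t\<close> are irrelevant.\<close>

definition edge_coloring :: "tree \<Rightarrow> color list \<Rightarrow> (bool list \<Rightarrow> color) \<Rightarrow> bool" where
  "edge_coloring t c f \<longleftrightarrow>
    length c = leaves t \<and>
    (\<forall>i < leaves t. f (leaf_list t ! i) = c ! i) \<and>
    (\<forall>u \<in> internal t. f u + f (u @ [False]) + f (u @ [True]) = 0)"

definition proper_edge_coloring :: "tree \<Rightarrow> (bool list \<Rightarrow> color) \<Rightarrow> bool" where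
  "proper_edge_coloring t f \<longleftrightarrow>
    (\<forall>u \<in> internal t. distinct [f u, f (u @ [False]), f (u @ [True])])"

definition valid :: "tree \<Rightarrow> color list \<Rightarrow> bool" where
  "valid t c \<longleftrightarrow>
    (\<exists>f. edge_coloring t c f \<and> proper_edge_coloring t f \<and> f ` vertices t \<subseteq> nonzero_colors)"

definition colorings :: "tree \<Rightarrow> tree \<Rightarrow> color list set" where
  "colorings D R = {c. valid D c \<and> valid R c}"

definition has_coloring :: "(tree \<times> tree) set \<Rightarrow> bool" where
  "has_coloring x \<longleftrightarrow> (\<exists>D R. (D, R) \<in> x \<and> colorings D R \<noteq> {})"

definition recoloring :: "(color list \<times> color list) set" where
  "recoloring = {(c, map p c) |c p. p permutes nonzero_colors}"

definition colorings_mod_S3 :: "tree \<Rightarrow> tree \<Rightarrow> color list set set" where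
  "colorings_mod_S3 D R = colorings D R // Restr recoloring (colorings D R)"

text \<open>A class contains only one prime pair with second tree a right vine, so the quantifier
  over such pairs speaks about that pair.\<close>

definition has_unique_coloring :: "(tree \<times> tree) set \<Rightarrow> bool" where
  "has_unique_coloring x \<longleftrightarrow>
    (\<forall>D V. (D, V) \<in> x \<and> right_vine V \<and> prime_pair D V \<longrightarrow> card (colorings_mod_S3 D V) = 1)"


section \<open>Thompson's group is a group\<close>

text \<open>\<open>graft t fs\<close> attaches the trees \<open>fs\<close> to the leaves of \<open>t\<close> in order.\<close>

fun graft :: "tree \<Rightarrow> tree list \<Rightarrow> tree" where
  "graft Leaf fs = hd fs"
| "graft (Node l r) fs = Node (graft l (take (leaves l) fs)) (graft r (drop (leaves l) fs))"

fun fgraft :: "tree list \<Rightarrow> tree list \<Rightarrow> tree list" where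
  "fgraft [] gs = []"
| "fgraft (f # fs) gs = graft f (take (leaves f) gs) # fgraft fs (drop (leaves f) gs)"

abbreviation fl :: "tree list \<Rightarrow> nat" where "fl fs \<equiv> sum_list (map leaves fs)"

lemma leaves_pos: "leaves t > 0"
  by (induction t) auto

lemma len_fgraft[simp]: "length (fgraft fs gs) = length fs"
  by (induction fs arbitrary: gs) auto

lemma fl_take_drop: "fl (take k fs) + fl (drop k fs) = fl fs"
  by (metis append_take_drop_id map_append sum_list_append)

lemma leaves_graft: "length fs = leaves t \<Longrightarrow> leaves (graft t fs) = fl fs"
proof (induction t arbitrary: fs)
  case Leaf then show ?case by (cases fs) auto
next
  case (Node l r)
  then have "leaves (graft l (take (leaves l) fs)) = fl (take (leaves l) fs)"
    "leaves (graft r (drop (leaves l) fs)) = fl (drop (leaves l) fs)"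
    by auto
  then show ?case by (simp add: fl_take_drop)
qed

lemma fgraft_append: "fgraft (xs @ ys) gs = fgraft xs (take (fl xs) gs) @ fgraft ys (drop (fl xs) gs)"
  by (induction xs arbitrary: gs) (auto simp: take_drop add.commute min_def)

lemma fl_fgraft: "length gs = fl fs \<Longrightarrow> fl (fgraft fs gs) = fl gs"
  by (induction fs arbitrary: gs) (auto simp: leaves_graft fl_take_drop)

lemma graft_assoc:
  "length fs = leaves t \<Longrightarrow> length gs = fl fs \<Longrightarrow> graft (graft t fs) gs = graft t (fgraft fs gs)"
proof (induction t arbitrary: fs gs)
  case Leaf then show ?case by (cases fs) auto
next
  case (Node l r)
  define a where "a = take (leaves l) fs"
  define b where "b = drop (leaves l) fs"
  have fs: "fs = a @ b" and la: "length a = leaves l" and lb: "length b = leaves r"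
    using Node.prems by (auto simp: a_def b_def)
  show ?case using Node.prems la lb
    by (simp add: fs fgraft_append leaves_graft Node.IH)
qed

lemma graft_id: "graft t (replicate (leaves t) Leaf) = t"
  by (induction t) auto

lemma graft_cancel:
  "length fs = leaves t \<Longrightarrow> length gs = leaves t \<Longrightarrow> graft t fs = graft t gs \<Longrightarrow> fs = gs"
proof (induction t arbitrary: fs gs)
  case Leaf then show ?case by (cases fs; cases gs) auto
next
  case (Node l r)
  then have "take (leaves l) fs = take (leaves l) gs" "drop (leaves l) fs = drop (leaves l) gs"
    by auto
  then show ?case by (metis append_take_drop_id)
qed

lemma graft_common:
  "\<exists>f g. length f = leaves A \<and> length g = leaves B \<and> graft A f = graft B g"
proof (induction A arbitrary: B)
  case Leaf
  have "graft Leaf [B] = graft B (replicate (leaves B) Leaf)" by (simp add: graft_id)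
  then show ?case by (metis length_replicate leaf_list.simps(1) length_Cons list.size(3))
next
  case (Node l r)
  show ?case
  proof (cases B)
    case Leaf
    have "graft (Node l r) (replicate (leaves (Node l r)) Leaf) = graft Leaf [Node l r]"
      by (simp only: graft_id graft.simps list.sel)
    then show ?thesis unfolding Leaf by (metis length_replicate leaf_list.simps(1) length_Cons list.size(3))
  next
    case (Node l' r')
    obtain f g where 1: "length f = leaves l" "length g = leaves l'" "graft l f = graft l' g"
      using Node.IH(1) by blast
    obtain f' g' where 2: "length f' = leaves r" "length g' = leaves r'" "graft r f' = graft r' g'"
      using Node.IH(2) by blast
    show ?thesis unfolding Node
      by (rule exI[of _ "f @ f'"], rule exI[of _ "g @ g'"]) (simp add: 1 2)
  qed
qed

lemma fgraft_common:
  "length fs = length gs \<Longrightarrow>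
   \<exists>p q. length p = fl fs \<and> length q = fl gs \<and> fgraft fs p = fgraft gs q"
proof (induction fs gs rule: list_induct2)
  case Nil then show ?case by simp
next
  case (Cons x xs y ys)
  obtain p q where 1: "length p = fl xs" "length q = fl ys" "fgraft xs p = fgraft ys q"
    using Cons.IH by blast
  obtain f g where 2: "length f = leaves x" "length g = leaves y" "graft x f = graft y g"
    using graft_common by blast
  show ?case
    by (rule exI[of _ "f @ p"], rule exI[of _ "g @ q"]) (simp add: 1 2)
qed

lemma add_caret_graft:
  "i < leaves t \<Longrightarrow> add_caret i t = graft t ((replicate (leaves t) Leaf)[i := Node Leaf Leaf])"
proof (induction t arbitrary: i)
  case Leaf then show ?case by simp
next
  case (Node l r)
  have eq: "(replicate (leaves (Node l r)) Leaf)[i := Node Leaf Leaf] =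
     (if i < leaves l then (replicate (leaves l) Leaf)[i := Node Leaf Leaf] @ replicate (leaves r) Leaf
      else replicate (leaves l) Leaf @ (replicate (leaves r) Leaf)[i - leaves l := Node Leaf Leaf])"
    by (simp add: replicate_add list_update_append)
  show ?case unfolding eq using Node by (auto simp: graft_id)
qed

lemma leaves_add_caret: "i < leaves t \<Longrightarrow> leaves (add_caret i t) = Suc (leaves t)"
  by (induction t arbitrary: i) auto

lemma graft_add_caret:
  "length xs + 1 + length ys = leaves t \<Longrightarrow>
   graft (add_caret (length xs) t) (xs @ [a, b] @ ys) = graft t (xs @ Node a b # ys)"
proof (induction t arbitrary: xs ys)
  case Leaf then show ?case by simp
next
  case (Node l r)
  show ?case
  proof (cases "length xs < leaves l")
    case True
    define k where "k = leaves l - Suc (length xs)"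
    have k: "leaves l = length xs + Suc k" using True k_def by simp
    have lk: "k \<le> length ys" using Node.prems k by simp
    have "graft (add_caret (length xs) l) (xs @ [a, b] @ take k ys) = graft l (xs @ Node a b # take k ys)"
      by (rule Node.IH(1)) (use k lk in simp)
    moreover have "leaves (add_caret (length xs) l) = length xs + Suc (Suc k)"
      using leaves_add_caret[OF True] k by simp
    ultimately show ?thesis using True by (simp add: k)
  next
    case False
    define zs where "zs = drop (leaves l) xs"
    define ws where "ws = take (leaves l) xs"
    have xs: "xs = ws @ zs" "length ws = leaves l" using False by (auto simp: zs_def ws_def)
    have "graft (add_caret (length zs) r) (zs @ [a, b] @ ys) = graft r (zs @ Node a b # ys)"
      by (rule Node.IH(2)) (use Node.prems xs in simp)
    then show ?thesis using xs by simp
  qed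
qed

lemma step_rel: "(p, q) \<in> caret_step \<Longrightarrow> (p, q) \<in> F_rel"
  unfolding F_rel_def caret_step_def tree_pairs_def by (auto simp: leaves_add_caret)

lemma F_rel_equiv: "equiv tree_pairs F_rel"
proof (rule equivI)
  show "refl_on tree_pairs F_rel" "F_rel \<subseteq> tree_pairs \<times> tree_pairs"
    unfolding F_rel_def by (auto simp: refl_on_def)
  have "sym ((caret_step \<union> caret_step\<inverse>)\<^sup>*)" by (intro sym_rtrancl) (auto simp: sym_def)
  then show "sym F_rel" unfolding F_rel_def sym_def by blast
  show "trans F_rel" unfolding F_rel_def trans_def by auto
qed

lemma F_rel_graft:
  "leaves A = leaves B \<Longrightarrow> length f = leaves A \<Longrightarrow> ((A, B), (graft A f, graft B f)) \<in> F_rel"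
proof (induction "sum_list (map size f)" arbitrary: A B f rule: less_induct)
  case less
  show ?case
  proof (cases "\<exists>x \<in> set f. x \<noteq> Leaf")
    case False
    then have "f = replicate (leaves A) Leaf" by (metis less.prems(2) replicate_eqI)
    then show ?thesis
      using less.prems F_rel_equiv graft_id[of A] graft_id[of B] unfolding equiv_def refl_on_def
      by (auto simp: tree_pairs_def)
  next
    case True
    then obtain a b where "Node a b \<in> set f" by (metis tree.exhaust)
    then obtain xs ys where f: "f = xs @ Node a b # ys" by (meson split_list)
    let ?i = "length xs" and ?g = "xs @ [a, b] @ ys"
    have i: "?i < leaves A" "?i < leaves B" using less.prems f by auto
    have "((A, B), (add_caret ?i A, add_caret ?i B)) \<in> F_rel"
      by (rule step_rel) (use i less.prems in \<open>auto simp: caret_step_def tree_pairs_def\<close>)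
    moreover have "((add_caret ?i A, add_caret ?i B),
        (graft (add_caret ?i A) ?g, graft (add_caret ?i B) ?g)) \<in> F_rel"
      by (rule less.hyps) (use i less.prems f in \<open>auto simp: leaves_add_caret\<close>)
    moreover have "graft (add_caret ?i A) ?g = graft A f" "graft (add_caret ?i B) ?g = graft B f"
      unfolding f by (rule graft_add_caret, use less.prems f in simp)+
    ultimately show ?thesis using F_rel_equiv unfolding equiv_def trans_def by metis
  qed
qed

definition common_graft :: "(tree \<times> tree) \<Rightarrow> (tree \<times> tree) \<Rightarrow> bool" where
  "common_graft p q \<longleftrightarrow> (\<exists>f g. length f = leaves (fst p) \<and> length g = leaves (fst q) \<and>
     graft (fst p) f = graft (fst q) g \<and> graft (snd p) f = graft (snd q) g)"

lemma common_graft_trans: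
  assumes "common_graft p q" "common_graft q r" "p \<in> tree_pairs" "q \<in> tree_pairs" "r \<in> tree_pairs"
  shows "common_graft p r"
proof -
  obtain f g where 1: "length f = leaves (fst p)" "length g = leaves (fst q)"
     "graft (fst p) f = graft (fst q) g" "graft (snd p) f = graft (snd q) g"
    using assms(1) by (auto simp: common_graft_def)
  obtain h k where 2: "length h = leaves (fst q)" "length k = leaves (fst r)"
     "graft (fst q) h = graft (fst r) k" "graft (snd q) h = graft (snd r) k"
    using assms(2) by (auto simp: common_graft_def)
  have t: "leaves (fst p) = leaves (snd p)" "leaves (fst q) = leaves (snd q)" "leaves (fst r) = leaves (snd r)"
    using assms by (auto simp: tree_pairs_def)
  obtain u v where 3: "length u = fl g" "length v = fl h" "fgraft g u = fgraft h v"
    using fgraft_common[of g h] 1 2 by auto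
  have lf: "fl f = fl g" "fl h = fl k" using 1 2 by (metis leaves_graft)+
  have "graft (fst p) (fgraft f u) = graft (fst r) (fgraft k v)"
    using 1 2 3 lf t by (metis graft_assoc)
  moreover have "graft (snd p) (fgraft f u) = graft (snd r) (fgraft k v)"
    using 1 2 3 lf t by (metis graft_assoc)
  ultimately show ?thesis unfolding common_graft_def using 1 2 by (metis len_fgraft)
qed

lemma common_graft_refl: "common_graft p p"
  unfolding common_graft_def by (metis length_replicate)

lemma common_graft_sym: "common_graft p q \<Longrightarrow> common_graft q p"
  unfolding common_graft_def by metis

lemma common_graft_step: "(p, q) \<in> caret_step \<Longrightarrow> common_graft p q \<and> p \<in> tree_pairs \<and> q \<in> tree_pairs"
proof -
  assume "(p, q) \<in> caret_step"
  then obtain A B i where pq: "p = (A, B)" "q = (add_caret i A, add_caret i B)" "leaves A = leaves B" "i < leaves A"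
    by (auto simp: caret_step_def tree_pairs_def)
  let ?f = "(replicate (leaves A) Leaf)[i := Node Leaf Leaf]"
  let ?g = "replicate (leaves (add_caret i A)) Leaf"
  have l: "leaves (add_caret i A) = leaves (add_caret i B)" using pq by (simp add: leaves_add_caret)
  have "graft A ?f = graft (add_caret i A) ?g"
    unfolding graft_id by (rule add_caret_graft[symmetric]) (use pq in simp)
  moreover have "graft B ?f = graft (add_caret i B) ?g"
    unfolding l graft_id pq(3) by (rule add_caret_graft[symmetric]) (use pq in simp)
  ultimately have "common_graft p q"
    unfolding common_graft_def pq fst_conv snd_conv 
    by - (rule exI[of _ ?f], rule exI[of _ ?g], simp add: pq(3))
  then show ?thesis using pq l by (simp add: tree_pairs_def)
qed

lemma F_rel_common_graft: "(p, q) \<in> F_rel \<Longrightarrow> common_graft p q"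
proof -
  assume "(p, q) \<in> F_rel"
  then have "(p, q) \<in> (caret_step \<union> caret_step\<inverse>)\<^sup>*" and p: "p \<in> tree_pairs" by (auto simp: F_rel_def)
  then have "common_graft p q \<and> q \<in> tree_pairs"
  proof (induction rule: rtrancl_induct)
    case base then show ?case using common_graft_refl by auto
  next
    case (step y z)
    then have "common_graft y z \<and> z \<in> tree_pairs" using common_graft_step common_graft_sym by blast
    then show ?case using step p common_graft_trans by blast
  qed
  then show ?thesis ..
qed

abbreviation cls :: "tree \<Rightarrow> tree \<Rightarrow> (tree \<times> tree) set" where "cls A B \<equiv> F_rel `` {(A, B)}"

lemma cls_graft: "leaves A = leaves B \<Longrightarrow> length f = leaves A \<Longrightarrow> cls (graft A f) (graft B f) = cls A B"
  using F_rel_graft F_rel_equiv equiv_class_eq by fastforce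

lemma compose_rel:
  assumes "((A, B), (A', B')) \<in> F_rel" "((B, C), (B', C')) \<in> F_rel"
  shows "((A, C), (A', C')) \<in> F_rel"
proof -
  obtain f g where 1: "length f = leaves A" "length g = leaves A'" "graft A f = graft A' g" "graft B f = graft B' g"
    using F_rel_common_graft[OF assms(1)] by (auto simp: common_graft_def)
  obtain h k where 2: "length h = leaves B" "length k = leaves B'" "graft B h = graft B' k" "graft C h = graft C' k"
    using F_rel_common_graft[OF assms(2)] by (auto simp: common_graft_def)
  have t: "leaves A = leaves B" "leaves A' = leaves B'" "leaves B = leaves C" "leaves B' = leaves C'"
    using assms by (auto simp: F_rel_def tree_pairs_def)
  obtain p q where 3: "length p = fl f" "length q = fl h" "fgraft f p = fgraft h q"
    using fgraft_common[of f h] 1 2 t by auto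
  have l: "fl f = fl g" "fl h = fl k" using 1 2 t by (metis leaves_graft)+
  have "graft B' (fgraft g p) = graft B' (fgraft k q)"
    using 1 2 3 l t by (metis graft_assoc)
  then have gk: "fgraft g p = fgraft k q" by (rule graft_cancel[rotated 2]) (use 1 2 t in simp_all)
  have a: "graft A (fgraft f p) = graft A' (fgraft g p)"
    using 1 2 3 l t by (metis graft_assoc)
  have c: "graft C (fgraft f p) = graft C' (fgraft g p)"
    using 1 2 3 l t gk by (metis graft_assoc)
  have "cls A C = cls (graft A (fgraft f p)) (graft C (fgraft f p))"
    by (rule cls_graft[symmetric]) (use 1 t in simp_all)
  also have "\<dots> = cls A' C'" unfolding a c by (rule cls_graft) (use 1 t in simp_all)
  finally show ?thesis using F_rel_equiv t by (simp add: eq_equiv_class_iff tree_pairs_def)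
qed

lemma carrier_cls: "x \<in> carrier thompson_F \<longleftrightarrow> (\<exists>A B. leaves A = leaves B \<and> x = cls A B)"
  by (auto simp: thompson_F_def quotient_def tree_pairs_def)

lemma thompson_F_mult:
  assumes "leaves A = leaves B" "leaves B = leaves C"
  shows "cls A B \<otimes>\<^bsub>thompson_F\<^esub> cls B C = cls A C"
proof -
  let ?S = "{(A', C') |A' B' C'. (A', B') \<in> cls A B \<and> (B', C') \<in> cls B C}"
  have sub: "\<And>z. z \<in> ?S \<Longrightarrow> F_rel `` {z} = cls A C"
    using compose_rel equiv_class_eq[OF F_rel_equiv] by fastforce
  have "(A, B) \<in> cls A B" "(B, C) \<in> cls B C"
    using assms F_rel_equiv by (auto simp: equiv_def refl_on_def tree_pairs_def)
  then have "(A, C) \<in> ?S" by blast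
  then have "F_rel `` ?S = cls A C" using sub by blast
  then show ?thesis by (simp add: thompson_F_def)
qed

lemma cls_match:
  assumes "leaves A = leaves B" "leaves C = leaves D"
  obtains A' E D' where "cls A B = cls A' E" "cls C D = cls E D'" "leaves A' = leaves E" "leaves E = leaves D'"
proof -
  obtain f g where "length f = leaves B" "length g = leaves C" "graft B f = graft C g"
    using graft_common by blast
  then show ?thesis using that[of "graft A f" "graft B f" "graft D g"] assms cls_graft leaves_graft
    by metis
qed

lemma cls_same: "cls A A = \<one>\<^bsub>thompson_F\<^esub>"
proof -
  have "cls (graft Leaf [A]) (graft Leaf [A]) = cls Leaf Leaf" by (rule cls_graft) simp_all
  then show ?thesis by (simp add: thompson_F_def)
qed

lemma carrier_pair:
  assumes "x \<in> carrier thompson_F" "y \<in> carrier thompson_F"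
  obtains A B C where "x = cls A B" "y = cls B C" "leaves A = leaves B" "leaves B = leaves C"
proof -
  obtain A B C D where "x = cls A B" "leaves A = leaves B" "y = cls C D" "leaves C = leaves D"
    using assms unfolding carrier_cls by blast
  then show ?thesis using that cls_match by metis
qed

lemma group_thompson_F: "group thompson_F"
proof (rule groupI)
  fix x y assume "x \<in> carrier thompson_F" "y \<in> carrier thompson_F"
  then obtain A B C where "x = cls A B" "y = cls B C" "leaves A = leaves B" "leaves B = leaves C"
    by (metis carrier_pair)
  then show "x \<otimes>\<^bsub>thompson_F\<^esub> y \<in> carrier thompson_F" by (metis thompson_F_mult carrier_cls)
next
  show "\<one>\<^bsub>thompson_F\<^esub> \<in> carrier thompson_F" using cls_same carrier_cls by metis
next
  fix x y z assume "x \<in> carrier thompson_F" "y \<in> carrier thompson_F" "z \<in> carrier thompson_F"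
  then obtain A B C C' D where 1: "x = cls A B" "y = cls B C" "z = cls C' D"
      "leaves A = leaves B" "leaves B = leaves C" "leaves C' = leaves D"
    by (metis carrier_pair carrier_cls)
  obtain f g where 2: "length f = leaves C" "length g = leaves C'" "graft C f = graft C' g"
    using graft_common by blast
  define A1 B1 C1 D1 where "A1 = graft A f" and "B1 = graft B f" and "C1 = graft C f" and "D1 = graft D g"
  note d = this
  have "x = cls A1 B1" "y = cls B1 C1" "z = cls C1 D1"
    unfolding d using 1 2 by (metis cls_graft)+
  moreover have "leaves A1 = leaves B1" "leaves B1 = leaves C1" "leaves C1 = leaves D1"
    unfolding d using 1 2 by (metis leaves_graft)+
  ultimately show "x \<otimes>\<^bsub>thompson_F\<^esub> y \<otimes>\<^bsub>thompson_F\<^esub> z = x \<otimes>\<^bsub>thompson_F\<^esub> (y \<otimes>\<^bsub>thompson_F\<^esub> z)"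
    by (metis thompson_F_mult)
next
  fix x assume "x \<in> carrier thompson_F"
  then obtain A B where x: "x = cls A B" "leaves A = leaves B" unfolding carrier_cls by blast
  then show "\<one>\<^bsub>thompson_F\<^esub> \<otimes>\<^bsub>thompson_F\<^esub> x = x"
    using thompson_F_mult[of A A B] cls_same by simp
  have "cls B A \<otimes>\<^bsub>thompson_F\<^esub> x = \<one>\<^bsub>thompson_F\<^esub>"
    using thompson_F_mult[of B A B] x cls_same by simp
  then show "\<exists>y\<in>carrier thompson_F. y \<otimes>\<^bsub>thompson_F\<^esub> x = \<one>\<^bsub>thompson_F\<^esub>"
    using x carrier_cls by metis
qed


section \<open>A color vector determines its edge coloring\<close>

lemma Nil_vertices: "[] \<in> vertices t"
  by (cases t) (auto simp: vertices_def)

lemma bit_color_add: "(x::color) + y + z = 0 \<longleftrightarrow> x = y + z"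
  by (cases x; cases y; cases z) (auto simp: add_eq_0_iff2 zero_prod_def algebra_simps)

lemma edge_coloring_Node:
  "edge_coloring (Node l r) c f \<longleftrightarrow> length c = leaves l + leaves r \<and>
     edge_coloring l (take (leaves l) c) (\<lambda>u. f (False # u)) \<and>
     edge_coloring r (drop (leaves l) c) (\<lambda>u. f (True # u)) \<and> f [] = f [False] + f [True]"
proof -
  have "(\<forall>i < leaves (Node l r). P i) \<longleftrightarrow> (\<forall>i < leaves l. P i) \<and> (\<forall>i < leaves r. P (leaves l + i))" for P
    by (auto, metis add_diff_inverse_nat nat_add_left_cancel_less)
  then show ?thesis
    unfolding edge_coloring_def by (auto simp: nth_append bit_color_add)
qed

lemma edge_coloring_unique:
  "edge_coloring t c f \<Longrightarrow> edge_coloring t c g \<Longrightarrow> u \<in> vertices t \<Longrightarrow> f u = g u"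
proof (induction t arbitrary: c f g u)
  case Leaf then show ?case by (simp add: edge_coloring_def vertices_def)
next
  case (Node l r)
  have l: "f (False # v) = g (False # v)" if "v \<in> vertices l" for v
    using Node.IH(1)[OF _ _ that] Node.prems unfolding edge_coloring_Node by blast
  have r: "f (True # v) = g (True # v)" if "v \<in> vertices r" for v
    using Node.IH(2)[OF _ _ that] Node.prems unfolding edge_coloring_Node by blast
  have "f [] = g []" using l[OF Nil_vertices] r[OF Nil_vertices] Node.prems unfolding edge_coloring_Node by simp
  then show ?case using Node.prems(3) l r by (auto simp: vertices_def)
qed

lemma edge_coloring_exists: "length c = leaves t \<Longrightarrow> \<exists>f. edge_coloring t c f"
proof (induction t arbitrary: c)
  case Leaf then show ?case by (auto simp: edge_coloring_def)
next
  case (Node l r)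
  obtain f where f: "edge_coloring l (take (leaves l) c) f" using Node by force
  obtain g where g: "edge_coloring r (drop (leaves l) c) g" using Node by force
  define h where "h = (\<lambda>u. case u of [] \<Rightarrow> f [] + g [] | b # v \<Rightarrow> if b then g v else f v)"
  show ?case
    by (rule exI[of _ h]) (use f g Node.prems in \<open>auto simp: edge_coloring_Node h_def\<close>)
qed

section \<open>Prime pairs with a right vine\<close>

lemma right_vine_Node: "right_vine (Node l r) \<longleftrightarrow> l = Leaf \<and> right_vine r"
proof (cases l)
  case Leaf
  have "right_vine (Node Leaf r) = right_vine r" 
  proof
    assume "right_vine r" then show "right_vine (Node Leaf r)"
      unfolding right_vine_def by (auto intro: exI[of _ 0]) (metis replicate_Suc)
  next
    assume "right_vine (Node Leaf r)" then show "right_vine r"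
      unfolding right_vine_def by (auto simp: Cons_replicate_eq)
  qed
  then show ?thesis using Leaf by simp
next
  case (Node a b)
  then show ?thesis unfolding right_vine_def by (auto simp: Cons_replicate_eq)
qed

lemma segments_bound: "s \<in> segments_from a t \<Longrightarrow> \<exists>x y. s = {x, y} \<and> a \<le> x \<and> x < y \<and> y \<le> a + leaves t"
proof (induction t arbitrary: a)
  case Leaf then show ?case by auto
next
  case (Node l r)
  show ?case
  proof -
    consider "s = {a, a + leaves (Node l r)}" | "s \<in> segments_from a l" | "s \<in> segments_from (a + leaves l) r"
      using Node.prems by auto
    then show ?thesis
    proof cases
      case 1 then show ?thesis using leaves_pos[of "Node l r"] by (intro exI[of _ a] exI[of _ "a + leaves (Node l r)"]) auto
    next
      case 2 then show ?thesis using Node.IH(1) by fastforce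
    next
      case 3 then show ?thesis using Node.IH(2) by fastforce
    qed
  qed
qed

lemma root_segment: "{a, a + leaves t} \<in> segments_from a t"
  by (cases t) auto

lemma vine_segments:
  "right_vine V \<Longrightarrow> segments_from a V = {{i, i + 1} |i. a \<le> i \<and> i < a + leaves V} \<union> {{k, a + leaves V} |k. a \<le> k \<and> k < a + leaves V}"
proof (induction V arbitrary: a)
  case Leaf then show ?case by (auto simp: le_less_Suc_eq)
next
  case (Node l r)
  then have l: "l = Leaf" and r: "right_vine r" by (auto simp: right_vine_Node)
  have IH: "segments_from (Suc a) r = {{i, i + 1} |i. Suc a \<le> i \<and> i < Suc a + leaves r} \<union> {{k, Suc a + leaves r} |k. Suc a \<le> k \<and> k < Suc a + leaves r}"
    by (rule Node.IH(2)[OF r])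
  have n: "leaves (Node l r) = Suc (leaves r)" by (simp add: l)
  have s: "segments_from a (Node l r) = insert {a, a + Suc (leaves r)} (insert {a, Suc a} (segments_from (Suc a) r))"
    by (simp add: l)
  have 1: "{{i, i + 1} |i. a \<le> i \<and> i < a + Suc m} = insert {a, Suc a} {{i, i + 1} |i. Suc a \<le> i \<and> i < Suc a + m}" for m
    by (auto simp: Suc_le_eq)
  have 2: "{{k, a + Suc m} |k. a \<le> k \<and> k < a + Suc m} = insert {a, a + Suc m} {{k, Suc a + m} |k. Suc a \<le> k \<and> k < Suc a + m}" for m
    by (auto simp: Suc_le_eq)
  show ?case unfolding n s IH 1 2 by auto
qed

lemma prime_pair_iff: 
  "prime_pair D R \<longleftrightarrow> leaves D = leaves R \<and> leaves D \<ge> 2 \<and> diagonals D \<inter> diagonals R = {}"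
proof
  assume p: "prime_pair D R"
  have False if "s \<in> diagonals D" "s \<in> diagonals R" for s
  proof -
    have "Fst_diagonal s \<in> glued_edges D R" "Snd_diagonal s \<in> glued_edges D R"
      using that unfolding glued_edges_def by auto
    then show False using p unfolding prime_pair_def by (metis glued_edge.distinct(5) glued_edge.sel(2,3))
  qed
  then show "leaves D = leaves R \<and> leaves D \<ge> 2 \<and> diagonals D \<inter> diagonals R = {}"
    using p unfolding prime_pair_def by blast
next
  assume "leaves D = leaves R \<and> leaves D \<ge> 2 \<and> diagonals D \<inter> diagonals R = {}"
  then show "prime_pair D R"
    unfolding prime_pair_def glued_edges_def diagonals_def by auto
qed

lemma prime_vine:
  assumes "right_vine V" "leaves D = leaves V" "leaves D \<ge> 2"
  shows "prime_pair D V \<longleftrightarrow> (\<exists>l. D = Node l Leaf)"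
proof
  assume p: "prime_pair D V"
  obtain l r where D: "D = Node l r" using assms(3) by (cases D) auto
  show "\<exists>l. D = Node l Leaf"
  proof (cases r)
    case Leaf then show ?thesis using D by blast
  next
    case (Node a b)
    let ?n = "leaves D" let ?s = "{leaves l, ?n}"
    have n: "?n = leaves l + leaves a + leaves b" using D Node by simp
    have pos: "leaves l > 0" "leaves a > 0" "leaves b > 0" by (rule leaves_pos)+
    have "?s \<in> segments_from 0 D" using D root_segment[of "leaves l" r] by simp
    moreover have "?s \<in> segments_from 0 V" unfolding vine_segments[OF assms(1)]
    proof (rule UnI2)
      have "leaves l < leaves V" using assms(2) n pos by linarith
      then show "?s \<in> {{k, 0 + leaves V} |k. 0 \<le> k \<and> k < 0 + leaves V}" using assms(2) by auto
    qed
    moreover have "Suc (leaves l) < ?n" "0 < leaves l" using n pos by linarith+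
    then have "?s \<notin> polygon_sides ?n" unfolding polygon_sides_def by (auto simp: doubleton_eq_iff)
    ultimately show ?thesis using p assms(2) unfolding prime_pair_iff diagonals_def by auto
  qed
next
  assume "\<exists>l. D = Node l Leaf"
  then obtain l where D: "D = Node l Leaf" by blast
  have "diagonals D \<inter> diagonals V = {}"
  proof (rule ccontr)
    assume "\<not> ?thesis"
    then obtain s where s: "s \<in> diagonals D" "s \<in> diagonals V" by blast
    have sn: "s \<notin> polygon_sides (leaves D)" using s unfolding diagonals_def by simp
    obtain k where k: "s = {k, leaves D}" "k < leaves D"
      using s(2) sn assms(2) unfolding diagonals_def vine_segments[OF assms(1)] polygon_sides_def by auto
    have "s \<in> segments_from 0 l"
      using s(1) sn D unfolding diagonals_def polygon_sides_def by auto
    then obtain x y where "s = {x, y}" "x < y" "y \<le> leaves l" using segments_bound[of s 0 l] by auto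
    then show False using k D by (auto simp: doubleton_eq_iff)
  qed
  then show "prime_pair D V" using assms unfolding prime_pair_iff by blast
qed

end

theory Submission
  imports Defs
begin

text \<open>A color vector \<open>c\<close> is the list of differences of a coloring of the polygon corners
  \<open>0, \<dots>, n\<close> by \<open>\<int>\<^sub>2 \<times> \<int>\<^sub>2\<close>: give corner \<open>n\<close> the color \<open>0\<close> and corner \<open>i\<close> the sum of \<open>c\<close> from
  position \<open>i\<close> on. The edge color of a tree above a vertex with descendant leaves \<open>a, \<dots>, b - 1\<close>
  is then the difference of the colors of the corners \<open>a\<close> and \<open>b\<close>. Hence \<open>c\<close> is valid for a tree
  exactly when the corner coloring is a proper vertex coloring of the dual triangulation.

  The triangulation dual to a right vine is a fan: corner \<open>n\<close> is joined to every other corner.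
  Once the sides of the polygon are properly colored, validity for the vine therefore says that
  all other corners avoid the color \<open>0\<close>, so that they use the three nonzero colors only. Now a triangulated polygon has exactly one proper coloring
  with three colors once the two ends of one side are colored: every triangle forces the
  color of its third corner (\<open>three_coloring_unique\<close>).

  For a pair \<open>(D, V)\<close> with \<open>V\<close> a right vine, removing corner \<open>n\<close> from the triangulation of \<open>D\<close>
  leaves a chain of triangulated polygons, the duals of the left subtrees hanging off the right
  spine of \<open>D\<close>, consecutive ones sharing a corner. They can be three-colored one after the
  other, which gives existence (\<open>fan_coloring_exists\<close>). The pair is prime exactly when the chain
  consists of one polygon, that is \<open>D = Node l Leaf\<close>. In that case a coloring is determined by
  the two colors at the ends of the root side of \<open>l\<close>, and any ordered pair of distinct nonzero
  colors can be moved to any other by a permutation of the nonzero colors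
  (\<open>prime_colorings_transitive\<close>).\<close>

section \<open>Arithmetic of the four colors\<close>

lemma color_add_self: "(x::color) + x = 0"
  by (cases x) (simp add: zero_prod_def)

lemma color_add_eq_0: "(x::color) + y = 0 \<longleftrightarrow> x = y"
  using bit_color_add[of x y 0] by simp

lemma color_add_cancel: "(x::color) + (x + y) = y" "x + y + y = x"
  by (simp add: add.assoc[symmetric] color_add_self) (simp add: add.assoc color_add_self)

lemma nonzero_colors_iff: "x \<in> nonzero_colors \<longleftrightarrow> x \<noteq> 0"
proof (cases x)
  case (Pair a b)
  then show ?thesis by (cases a; cases b) (auto simp: nonzero_colors_def zero_prod_def)
qed

lemma third_color:
  fixes p q m :: color
  assumes "p \<noteq> 0" "q \<noteq> 0" "p \<noteq> q"
  shows "m \<noteq> 0 \<and> m \<noteq> p \<and> m \<noteq> q \<longleftrightarrow> m = p + q"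
proof -
  obtain a b where p: "p = (a, b)" by (cases p)
  obtain c d where q: "q = (c, d)" by (cases q)
  obtain e f where m: "m = (e, f)" by (cases m)
  show ?thesis using assms unfolding p q m
    by (cases a; cases b; cases c; cases d; cases e; cases f) (auto simp: zero_prod_def)
qed

lemma another_color:
  fixes q :: color
  shows "\<exists>m. m \<noteq> 0 \<and> m \<noteq> q"
proof (cases "q = (0, 1)")
  case True
  then show ?thesis by (intro exI[of _ "(1, 0)"]) (simp add: zero_prod_def)
next
  case False
  then show ?thesis by (intro exI[of _ "(0, 1)"]) (auto simp: zero_prod_def)
qed

text \<open>A permutation fixing \<open>0\<close> of the Klein four-group is an automorphism; only sums of
  distinct nonzero colors occur in the colorings of interest.\<close>

lemma permutes_third_color:
  assumes "\<pi> permutes nonzero_colors" "p \<noteq> 0" "q \<noteq> 0" "p \<noteq> q"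
  shows "\<pi> (p + q) = \<pi> p + \<pi> q"
proof -
  have nz: "\<pi> x \<noteq> 0 \<longleftrightarrow> x \<noteq> 0" for x
    using permutes_in_image[OF assms(1), of x] by (simp add: nonzero_colors_iff)
  have inj: "\<pi> x = \<pi> y \<longleftrightarrow> x = y" for x y
    using inj_eq[OF permutes_inj[OF assms(1)]] .
  show ?thesis
    using third_color[of p q "p + q"] third_color[of "\<pi> p" "\<pi> q" "\<pi> (p + q)"] assms nz inj
    by simp
qed

lemma permutation_of_colors_exists:
  assumes "p \<noteq> 0" "q \<noteq> 0" "p \<noteq> q" "p' \<noteq> 0" "q' \<noteq> 0" "p' \<noteq> q'"
  shows "\<exists>\<pi>. \<pi> permutes nonzero_colors \<and> \<pi> p = p' \<and> \<pi> q = q'"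
proof -
  define \<sigma> where "\<sigma> = transpose p p'"
  have \<sigma>: "\<sigma> permutes nonzero_colors"
    unfolding \<sigma>_def by (rule permutes_swap_id) (use assms in \<open>simp_all add: nonzero_colors_iff\<close>)
  have \<sigma>p: "\<sigma> p = p'" by (simp add: \<sigma>_def)
  have \<sigma>q: "\<sigma> q \<noteq> p'"
    using permutes_inj[OF \<sigma>] \<sigma>p assms(3) by (metis injD)
  have "\<sigma> q \<in> nonzero_colors"
    using permutes_in_image[OF \<sigma>] assms(2) by (simp add: nonzero_colors_iff)
  then have "transpose (\<sigma> q) q' permutes nonzero_colors"
    by (rule permutes_swap_id) (use assms in \<open>simp add: nonzero_colors_iff\<close>)
  then have "transpose (\<sigma> q) q' \<circ> \<sigma> permutes nonzero_colors"
    by (rule permutes_compose[OF \<sigma>])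
  moreover have "(transpose (\<sigma> q) q' \<circ> \<sigma>) p = p'"
    using \<sigma>q assms(6) by (simp add: \<sigma>p transpose_def)
  moreover have "(transpose (\<sigma> q) q' \<circ> \<sigma>) q = q'" by simp
  ultimately show ?thesis by blast
qed


section \<open>Validity as nonvanishing of sums\<close>

lemma edge_coloring_root: "edge_coloring t c f \<Longrightarrow> f [] = sum_list c"
proof (induction t arbitrary: c f)
  case Leaf
  then show ?case by (cases c) (auto simp: edge_coloring_def)
next
  case (Node l r)
  have "f [False] = sum_list (take (leaves l) c)" "f [True] = sum_list (drop (leaves l) c)"
    using Node.prems Node.IH unfolding edge_coloring_Node by blast+
  then show ?case
    using Node.prems unfolding edge_coloring_Node
    by (metis append_take_drop_id sum_list_append)
qed

lemma valid_length: "valid t c \<Longrightarrow> length c = leaves t"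
  by (auto simp: valid_def edge_coloring_def)

lemma valid_Leaf: "valid Leaf c \<longleftrightarrow> (\<exists>x. c = [x] \<and> x \<noteq> 0)"
proof
  assume "valid Leaf c"
  then show "\<exists>x. c = [x] \<and> x \<noteq> 0"
    by (cases c) (auto simp: valid_def edge_coloring_def vertices_def nonzero_colors_iff)
next
  assume "\<exists>x. c = [x] \<and> x \<noteq> 0"
  then obtain x where "c = [x]" "x \<noteq> 0" by blast
  then show "valid Leaf c"
    unfolding valid_def
    by (intro exI[of _ "\<lambda>_. x"])
      (auto simp: edge_coloring_def proper_edge_coloring_def vertices_def nonzero_colors_iff)
qed

lemma proper_edge_coloring_Node:
  "proper_edge_coloring (Node l r) f \<longleftrightarrow> distinct [f [], f [False], f [True]] \<and>
     proper_edge_coloring l (\<lambda>u. f (False # u)) \<and> proper_edge_coloring r (\<lambda>u. f (True # u))"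
  unfolding proper_edge_coloring_def by (simp add: ball_Un)

lemma vertices_Node:
  "vertices (Node l r) = insert [] ((#) False ` vertices l \<union> (#) True ` vertices r)"
  unfolding vertices_def by auto

text \<open>Three nonzero colors with sum \<open>0\<close> are distinct, so properness at a vertex comes down to
  the color of every edge there being nonzero; for the edge above the root vertex that color is
  \<open>sum_list c + sum_list d\<close>.\<close>

lemma valid_Node:
  assumes "length c = leaves l" "length d = leaves r"
  shows "valid (Node l r) (c @ d) \<longleftrightarrow> valid l c \<and> valid r d \<and> sum_list c \<noteq> sum_list d"
proof
  assume "valid (Node l r) (c @ d)"
  then obtain f where f: "edge_coloring (Node l r) (c @ d) f"
    "proper_edge_coloring (Node l r) f" "f ` vertices (Node l r) \<subseteq> nonzero_colors"
    unfolding valid_def by blast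
  have e: "edge_coloring l c (\<lambda>u. f (False # u))" "edge_coloring r d (\<lambda>u. f (True # u))"
    using f(1) assms by (simp_all add: edge_coloring_Node)
  have "valid l c" "valid r d"
    unfolding valid_def using e f(2,3)
    by (intro exI[of _ "\<lambda>u. f (False # u)"] exI[of _ "\<lambda>u. f (True # u)"];
        auto simp: proper_edge_coloring_Node vertices_Node)+
  moreover have "f [False] \<noteq> f [True]" using f(2) by (simp add: proper_edge_coloring_Node)
  ultimately show "valid l c \<and> valid r d \<and> sum_list c \<noteq> sum_list d"
    using e[THEN edge_coloring_root] by simp
next
  assume v: "valid l c \<and> valid r d \<and> sum_list c \<noteq> sum_list d"
  obtain f where f: "edge_coloring l c f" "proper_edge_coloring l f"
    "f ` vertices l \<subseteq> nonzero_colors"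
    using v unfolding valid_def by blast
  obtain g where g: "edge_coloring r d g" "proper_edge_coloring r g"
    "g ` vertices r \<subseteq> nonzero_colors"
    using v unfolding valid_def by blast
  define h where "h = (\<lambda>u. case u of [] \<Rightarrow> f [] + g [] | b # v \<Rightarrow> if b then g v else f v)"
  have h: "h [] = f [] + g []" "h (False # u) = f u" "h (True # u) = g u" for u
    by (simp_all add: h_def)
  have ne: "f [] \<noteq> g []" using v edge_coloring_root f(1) g(1) by metis
  have nz: "f [] \<noteq> 0" "g [] \<noteq> 0"
    using f(3) g(3) Nil_vertices by (auto simp: nonzero_colors_iff image_subset_iff)
  have third: "f [] + g [] \<noteq> 0 \<and> f [] + g [] \<noteq> f [] \<and> f [] + g [] \<noteq> g []"
    using third_color[OF nz ne] by blast
  have "edge_coloring (Node l r) (c @ d) h"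
    using f(1) g(1) assms by (simp add: edge_coloring_Node h)
  moreover have "proper_edge_coloring (Node l r) h"
    using f(2) g(2) ne third by (simp add: proper_edge_coloring_Node h)
  moreover have "h ` vertices (Node l r) \<subseteq> nonzero_colors"
    using f(3) g(3) third by (auto simp: vertices_Node h nonzero_colors_iff image_subset_iff)
  ultimately show "valid (Node l r) (c @ d)" unfolding valid_def by blast
qed

lemma valid_NodeE:
  assumes "valid (Node l r) c"
  obtains c1 c2 where "c = c1 @ c2" "valid l c1" "valid r c2" "sum_list c1 \<noteq> sum_list c2"
proof -
  have n: "length c = leaves l + leaves r" using valid_length[OF assms] by simp
  show thesis
    using that[of "take (leaves l) c" "drop (leaves l) c"] assms n
      valid_Node[of "take (leaves l) c" l "drop (leaves l) c" r]
    by simp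
qed

lemma valid_NodeI:
  "\<lbrakk>valid l c; valid r d; sum_list c \<noteq> sum_list d\<rbrakk> \<Longrightarrow> valid (Node l r) (c @ d)"
  by (simp add: valid_Node valid_length)

lemma valid_sum_nonzero: "valid t c \<Longrightarrow> sum_list c \<noteq> 0"
  unfolding valid_def using edge_coloring_root Nil_vertices
  by (metis image_subset_iff nonzero_colors_iff)

lemma valid_entries_nonzero: "valid t c \<Longrightarrow> 0 \<notin> set c"
  by (induction t arbitrary: c) (auto simp: valid_Leaf elim!: valid_NodeE)


section \<open>Corner colors and the fan of a right vine\<close>

text \<open>Here \<open>q\<close> is the color of the last corner and \<open>c\<close> lists the differences along the sides;
  all corners, the last one included, must avoid the color \<open>0\<close> of the apex of a fan.\<close>

fun corners_nonzero :: "color \<Rightarrow> color list \<Rightarrow> bool" where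
  "corners_nonzero q [] \<longleftrightarrow> q \<noteq> 0"
| "corners_nonzero q (x # xs) \<longleftrightarrow> x + sum_list xs + q \<noteq> 0 \<and> corners_nonzero q xs"

lemma corners_nonzero_append:
  "corners_nonzero q (xs @ ys) \<longleftrightarrow>
     corners_nonzero (sum_list ys + q) xs \<and> corners_nonzero q ys"
proof (induction xs)
  case Nil
  then show ?case by (cases ys) auto
next
  case (Cons x xs)
  then show ?case by (auto simp: add.assoc)
qed

text \<open>The last entry of the color vector is the difference between the apex and the corner
  before it, hence the color of that corner.\<close>

lemma valid_right_vine:
  assumes "right_vine V" "Suc (length xs) = leaves V" "0 \<notin> set xs"
  shows "valid V (xs @ [x]) \<longleftrightarrow> corners_nonzero x xs"
  using assms
proof (induction V arbitrary: xs)
  case Leaf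
  then show ?case by (simp add: valid_Leaf)
next
  case (Node l r)
  then have l: "l = Leaf" and r: "right_vine r" by (simp_all add: right_vine_Node)
  obtain y ys where xs: "xs = y # ys"
    using Node.prems(2) leaves_pos[of r] l by (cases xs) auto
  have n: "Suc (length ys) = leaves r" using Node.prems(2) l xs by simp
  have "valid (Node l r) (xs @ [x]) \<longleftrightarrow> valid Leaf [y] \<and> valid r (ys @ [x]) \<and> y \<noteq> sum_list ys + x"
    using valid_Node[of "[y]" Leaf "ys @ [x]" r] n by (simp add: l xs)
  then show ?case
    using Node.IH(2)[OF r n] Node.prems(3)
    by (auto simp: xs valid_Leaf add.assoc color_add_eq_0)
qed


section \<open>The three-coloring of a triangulated polygon\<close>

text \<open>For distinct nonzero \<open>p\<close> and \<open>q\<close> these are the differences along the sides when the first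
  corner has color \<open>p\<close>, the last one color \<open>q\<close>, and the third corner of each triangle receives the remaining nonzero color, which is
  the sum of the other two.\<close>

fun three_coloring :: "tree \<Rightarrow> color \<Rightarrow> color \<Rightarrow> color list" where
  "three_coloring Leaf p q = [p + q]"
| "three_coloring (Node l r) p q = three_coloring l p (p + q) @ three_coloring r (p + q) q"

lemma sum_three_coloring: "sum_list (three_coloring t p q) = p + q"
proof (induction t arbitrary: p q)
  case (Node l r)
  have "p + (p + q) + (p + q + q) = p + q" by (simp add: color_add_cancel add.commute)
  then show ?case by (simp add: Node.IH)
qed simp

text \<open>This is the uniqueness of three-colorings of triangulated polygons: the corner shared by the
  two subtrees has a nonzero color distinct from those of both ends, which leaves one choice.\<close>

lemma three_coloring_unique:
  assumes "p \<noteq> 0" "q \<noteq> 0" "p \<noteq> q"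
  shows "valid t c \<and> sum_list c = p + q \<and> corners_nonzero q c \<longleftrightarrow> c = three_coloring t p q"
  using assms
proof (induction t arbitrary: p q c)
  case Leaf
  have "p + q + q = p" by (rule color_add_cancel)
  then show ?case using Leaf.prems by (auto simp: valid_Leaf color_add_eq_0 simp del: split_paired_Ex)
next
  case (Node l r)
  have third: "p + q \<noteq> 0" "p + q \<noteq> p" "p + q \<noteq> q" using third_color[OF Node.prems] by blast+
  note IHl = Node.IH(1)[OF Node.prems(1) third(1) third(2)[symmetric]]
  note IHr = Node.IH(2)[OF third(1) Node.prems(2) third(3)]
  show ?case
  proof
    assume c: "valid (Node l r) c \<and> sum_list c = p + q \<and> corners_nonzero q c"
    then obtain c1 c2 where s: "c = c1 @ c2" "valid l c1" "valid r c2"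
      by (meson valid_NodeE)
    \<comment> \<open>the color of the corner shared by the polygons of \<open>l\<close> and \<open>r\<close>\<close>
    define m where "m = sum_list c2 + q"
    have c2: "sum_list c2 = m + q" by (simp add: m_def color_add_cancel)
    have "sum_list c1 + (m + q) = p + q" using c s(1) c2 by simp
    then have c1: "sum_list c1 = p + m" by (metis add.assoc add.commute add_right_cancel color_add_cancel(2))
    have corners: "corners_nonzero m c1" "corners_nonzero q c2"
      using c by (simp_all add: s(1) corners_nonzero_append m_def)
    then have "m \<noteq> 0" by (induction c1) auto
    moreover have "m \<noteq> p" "m \<noteq> q"
      using s(2,3)[THEN valid_sum_nonzero] c1 c2 by (auto simp: color_add_self)
    ultimately have m: "m = p + q" using third_color[OF Node.prems] by blast
    show "c = three_coloring (Node l r) p q"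
      using IHl[of c1] IHr[of c2] s c1 c2 corners unfolding m by simp
  next
    assume c: "c = three_coloring (Node l r) p q"
    define c1 c2 where "c1 = three_coloring l p (p + q)" and "c2 = three_coloring r (p + q) q"
    have c12: "c = c1 @ c2" by (simp add: c c1_def c2_def)
    have 1: "valid l c1" "sum_list c1 = q" "corners_nonzero (p + q) c1"
      using IHl[of c1] by (simp_all add: c1_def color_add_cancel)
    have 2: "valid r c2" "sum_list c2 = p" "corners_nonzero q c2"
      using IHr[of c2] by (simp_all add: c2_def color_add_cancel)
    show "valid (Node l r) c \<and> sum_list c = p + q \<and> corners_nonzero q c"
      using 1 2 Node.prems(3) valid_NodeI[of l c1 r c2]
      by (auto simp: c12 corners_nonzero_append add.commute)
  qed
qed

lemma map_three_coloring:
  assumes "\<pi> permutes nonzero_colors" "p \<noteq> 0" "q \<noteq> 0" "p \<noteq> q"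
  shows "map \<pi> (three_coloring t p q) = three_coloring t (\<pi> p) (\<pi> q)"
  using assms(2-)
proof (induction t arbitrary: p q)
  case Leaf
  then show ?case by (simp add: permutes_third_color[OF assms(1)])
next
  case (Node l r)
  have "p + q \<noteq> 0" "p + q \<noteq> p" "p + q \<noteq> q" using third_color[OF Node.prems] by blast+
  then show ?case using Node by (simp add: permutes_third_color[OF assms(1)])
qed


section \<open>Colorings of positive elements\<close>

text \<open>The polygon of the first left subtree on the right spine is three-colored between the
  prescribed color \<open>q\<close> of corner \<open>0\<close> and any other nonzero color \<open>m\<close>; the rest of the spine is
  colored starting from \<open>m\<close>.\<close>

lemma fan_coloring_exists:
  assumes "q \<noteq> 0"
  shows "\<exists>xs x. valid D (xs @ [x]) \<and> sum_list (xs @ [x]) = q \<and> corners_nonzero x xs"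
  using assms
proof (induction D arbitrary: q)
  case Leaf
  then show ?case by (intro exI[of _ "[]"] exI[of _ q]) (simp add: valid_Leaf)
next
  case (Node l r)
  obtain m where m: "m \<noteq> 0" "m \<noteq> q" using another_color by blast
  obtain xs x where r: "valid r (xs @ [x])" "sum_list (xs @ [x]) = m" "corners_nonzero x xs"
    using Node.IH(2)[OF m(1)] by blast
  define c where "c = three_coloring l q m"
  have l: "valid l c" "sum_list c = q + m" "corners_nonzero m c"
    using three_coloring_unique[of q m l c] Node.prems m by (auto simp: c_def)
  have "q + m \<noteq> m" using Node.prems by simp
  then have "valid (Node l r) (c @ xs @ [x])" using valid_NodeI[of l c r "xs @ [x]"] l r by simp
  moreover have "sum_list (c @ xs @ [x]) = q" 
    using l(2) r(2) by (simp add: color_add_cancel)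
  moreover have "corners_nonzero x (c @ xs)"
    using l(3) r(2,3) by (simp add: corners_nonzero_append)
  ultimately show ?case by (metis append.assoc)
qed

lemma colorings_right_vine_nonempty:
  assumes "right_vine V" "leaves D = leaves V"
  shows "colorings D V \<noteq> {}"
proof -
  \<comment> \<open>any nonzero color will do for corner \<open>0\<close>\<close>
  obtain xs x where c: "valid D (xs @ [x])" "corners_nonzero x xs"
    using fan_coloring_exists[of "(0, 1)" D] by (auto simp: zero_prod_def)
  have "valid V (xs @ [x])"
    using valid_right_vine[OF assms(1)] valid_length[OF c(1)] valid_entries_nonzero[OF c(1)] c(2)
      assms(2) by simp
  then show ?thesis using c(1) unfolding colorings_def by blast
qed


section \<open>Uniqueness for prime pairs\<close>

lemma prime_colorings:
  assumes "right_vine V" "leaves (Node l Leaf) = leaves V" "c \<in> colorings (Node l Leaf) V"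
  obtains p q where "p \<noteq> 0" "q \<noteq> 0" "p \<noteq> q" "c = three_coloring l p q @ [q]"
proof -
  have v: "valid (Node l Leaf) c" "valid V c" using assms(3) by (auto simp: colorings_def)
  from v(1) obtain xs q where c: "c = xs @ [q]" "valid l xs" "q \<noteq> 0" "sum_list xs \<noteq> q"
    by (auto elim!: valid_NodeE simp: valid_Leaf)
  define p where "p = sum_list xs + q"
  have s: "sum_list xs = p + q" by (simp add: p_def color_add_cancel)
  have p: "p \<noteq> 0" "p \<noteq> q"
    using c(4) valid_sum_nonzero[OF c(2)] by (simp_all add: p_def color_add_eq_0)
  have "corners_nonzero q xs"
    using valid_right_vine[OF assms(1), of xs q] v(2) assms(2) valid_length[OF c(2)]
      valid_entries_nonzero[OF c(2)] by (simp add: c(1))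
  then have "xs = three_coloring l p q"
    using three_coloring_unique[OF p(1) c(3) p(2)] c(2) s by blast
  then show thesis using that p c by blast
qed

lemma prime_colorings_transitive:
  assumes "right_vine V" "leaves (Node l Leaf) = leaves V"
    "c \<in> colorings (Node l Leaf) V" "d \<in> colorings (Node l Leaf) V"
  shows "(c, d) \<in> recoloring"
proof -
  obtain p q where c: "p \<noteq> 0" "q \<noteq> 0" "p \<noteq> q" "c = three_coloring l p q @ [q]"
    using prime_colorings[OF assms(1-3)] .
  obtain p' q' where d: "p' \<noteq> 0" "q' \<noteq> 0" "p' \<noteq> q'" "d = three_coloring l p' q' @ [q']"
    using prime_colorings[OF assms(1,2,4)] .
  obtain \<pi> where \<pi>: "\<pi> permutes nonzero_colors" "\<pi> p = p'" "\<pi> q = q'"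
    using permutation_of_colors_exists[OF c(1-3) d(1-3)] by blast
  then have "d = map \<pi> c" using map_three_coloring[OF \<pi>(1) c(1-3)] c(4) d(4) by simp
  then show ?thesis using \<pi>(1) unfolding recoloring_def by blast
qed

lemma card_prime_colorings_mod_S3:
  assumes "right_vine V" "leaves D = leaves V" "prime_pair D V"
  shows "card (colorings_mod_S3 D V) = 1"
proof -
  have "leaves D \<ge> 2" using assms(3) by (simp add: prime_pair_def)
  then obtain l where D: "D = Node l Leaf" using prime_vine assms by blast
  let ?S = "colorings D V"
  have "Restr recoloring ?S = ?S \<times> ?S"
    using prime_colorings_transitive[OF assms(1)] assms(2) unfolding D by blast
  then have "colorings_mod_S3 D V = {?S}"
    unfolding colorings_mod_S3_def
    using colorings_right_vine_nonempty[OF assms(1,2)] by (auto simp: quotient_def)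
  then show ?thesis by simp
qed

lemma leaves_eq_in_carrier:
  assumes "x \<in> carrier thompson_F" "(A, B) \<in> x"
  shows "leaves A = leaves B"
  using assms by (auto simp: thompson_F_def quotient_def F_rel_def tree_pairs_def)

theorem theorem8p5:
  shows "(\<forall>x \<in> positive_elements. has_coloring x) \<and>
         (\<forall>x \<in> prime_positive_elements. has_unique_coloring x)"
proof (intro conjI ballI)
  fix x assume "x \<in> positive_elements"
  then show "has_coloring x"
    unfolding positive_elements_def has_coloring_def
    using colorings_right_vine_nonempty leaves_eq_in_carrier by blast
next
  fix x assume "x \<in> prime_positive_elements"
  then have "x \<in> carrier thompson_F" by (simp add: prime_positive_elements_def)
  then show "has_unique_coloring x"
    unfolding has_unique_coloring_def
    using card_prime_colorings_mod_S3 leaves_eq_in_carrier by blast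
qed

end
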